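(* Fix $\sigma>0$ and $\lambda>0$. For each integer $P\ge 1$ let $x_0\in\mathbb{R}^P$ be a deterministic vector (depending on $P$) and let $Y=x_0+W$, where $W\sim\mathcal{N}(0,\sigma^2\mathrm{Id}_P)$. Assume that $\|x_0\|_4=o(P^{1/2})$ as $P\to\infty$. Let $\widehat h(P)>0$ be a deterministic sequence such that $\lim_{P\to\infty}\widehat h(P)=0$ and $\lim_{P\to\infty}P^{-1}\widehat h(P)^{-1}=0$. For $y\in\mathbb{R}^P$ define $$\mathrm{SCORE}\{\mathrm{HT}\}(y,\lambda,\widehat h(P))=\sum_{i=1}^P\left((y_i^2-\sigma^2)+I(|y_i|>\lambda)(2\sigma^2-y_i^2)+2\sigma\,\frac{\lambda\sqrt{\sigma^2+\widehat h(P)^2}}{\sqrt{2\pi}\,\widehat h(P)}\left[\exp\left(-\frac{(y_i+\lambda)^2}{2\widehat h(P)^2}\right)+\exp\left(-\frac{(y_i-\lambda)^2}{2\widehat h(P)^2}\right)\right]\right).$$ Then $$\operatorname*{plim}_{P\to\infty}\ \frac1P\left(\mathrm{SCORE}\{\mathrm{HT}\}(Y,\lambda,\widehat h(P))-\mathbb{E}_W\|\mathrm{HT}(Y,\lambda)-x_0\|^2\right)=0 .$$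
   Context: Hard thresholding: for $y\in\mathbb{R}^P$ and $\lambda>0$, $\mathrm{HT}(y,\lambda)\in\mathbb{R}^P$ is defined by $\mathrm{HT}(y,\lambda)_i=0$ if $|y_i|<\lambda$ and $\mathrm{HT}(y,\lambda)_i=y_i$ otherwise. $I(\omega)$ is the indicator of the event $\omega$; $\|\cdot\|$ is the Euclidean norm and $\|\cdot\|_4$ the $\ell^4$ norm on $\mathbb{R}^P$; $\mathbb{E}_W$ is the expectation with respect to $W$; $\operatorname{plim}$ denotes the limit in probability. *)

theory Defs
  imports "HOL-Probability.Probability"
begin

(* A vector of R^P is a function "nat \<Rightarrow> real" of which only the coordinates i < P matter;
   its Euclidean norm is "L2_set x {..<P}". *)

definition l4_norm :: "nat \<Rightarrow> (nat \<Rightarrow> real) \<Rightarrow> real" where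
  "l4_norm P x = root 4 (\<Sum>i<P. \<bar>x i\<bar> ^ 4)"

(* Density of N(0, \<sigma>^2 Id_P) with respect to Lebesgue measure on R^P. *)
definition iso_normal_density :: "nat \<Rightarrow> real \<Rightarrow> (nat \<Rightarrow> real) \<Rightarrow> real" where
  "iso_normal_density P \<sigma> w =
     1 / sqrt (2 * pi * \<sigma>\<^sup>2) ^ P * exp (- (L2_set w {..<P})\<^sup>2 / (2 * \<sigma>\<^sup>2))"

lemma iso_normal_density_eq_prod:
  "iso_normal_density P \<sigma> w = (\<Prod>i<P. normal_density 0 \<sigma> (w i))"
proof -
  have "(\<Sum>i<P. - (w i)\<^sup>2 / (2 * \<sigma>\<^sup>2)) = - (L2_set w {..<P})\<^sup>2 / (2 * \<sigma>\<^sup>2)"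
    by (simp add: L2_set_def sum_nonneg sum_divide_distrib sum_negf)
  then show ?thesis
    by (simp add: iso_normal_density_def normal_density_def prod_dividef
        flip: exp_sum)
qed

definition hard_threshold :: "(nat \<Rightarrow> real) \<Rightarrow> real \<Rightarrow> nat \<Rightarrow> real" where
  "hard_threshold y lam i = (if \<bar>y i\<bar> < lam then 0 else y i)"

definition score_HT :: "nat \<Rightarrow> real \<Rightarrow> (nat \<Rightarrow> real) \<Rightarrow> real \<Rightarrow> real \<Rightarrow> real" where
  "score_HT P \<sigma> y lam h =
     (\<Sum>i<P. ((y i)\<^sup>2 - \<sigma>\<^sup>2)
           + of_bool (\<bar>y i\<bar> > lam) * (2 * \<sigma>\<^sup>2 - (y i)\<^sup>2)
           + 2 * \<sigma> * ((lam * sqrt (\<sigma>\<^sup>2 + h\<^sup>2)) / (sqrt (2 * pi) * h))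
             * (exp (- (y i + lam)\<^sup>2 / (2 * h\<^sup>2)) + exp (- (y i - lam)\<^sup>2 / (2 * h\<^sup>2))))"

(* Each X n may live on its own probability space M n, as the limit c is a constant.
   The events are measurable when the X n are random variables. *)
definition plim_to :: "(nat \<Rightarrow> 'a measure) \<Rightarrow> (nat \<Rightarrow> 'a \<Rightarrow> real) \<Rightarrow> real \<Rightarrow> bool" where
  "plim_to M X c \<longleftrightarrow>
     (\<forall>\<epsilon>>0. (\<lambda>n. measure (M n) {\<omega> \<in> space (M n). \<bar>X n \<omega> - c\<bar> > \<epsilon>}) \<longlonglongrightarrow> 0)"

end

theory Submission
  imports Defs
begin

text \<open>
  Score and risk are both sums over coordinates, and the summands of the score are independent
  because the noise density is a product. Averaged over \<open>P\<close> coordinates, the score therefore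
  concentrates around its mean, and it remains to see that this mean is close to the risk and
  that the variance of a summand does not grow too fast as the bandwidth \<open>h\<close> shrinks.

  For the mean, Stein's identity (\<open>stein_hard_threshold\<close>) expresses the risk of a coordinate with
  signal \<open>x\<close> as the mean of the bounded function \<open>bounded_score\<close> plus
  \<open>2 * \<sigma>\<^sup>2 * lam\<close> times the density of the observation at the two thresholds \<open>\<plusminus> lam\<close>, where the
  estimator jumps. The exponentials in the score estimate these densities by kernels of width
  \<open>h\<close>. Their means are again Gaussian, with variance \<open>\<sigma>\<^sup>2 + h\<^sup>2\<close> instead of \<open>\<sigma>\<^sup>2\<close>, so the bias
  of a summand is of order \<open>h\<^sup>2\<close>, uniformly in \<open>x\<close> (\<open>score_bias\<close>).

  For the variance, the bounded part is harmless, and a kernel of width \<open>h\<close> and height of order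
  \<open>1 / h\<close> has a second moment of order \<open>1 / h\<close> (\<open>score_second_moment\<close>). By Chebyshev's
  inequality (\<open>prob_indep_mean_deviation\<close>), the probability of a deviation by more than
  \<open>\<epsilon>\<close> is at most a constant times \<open>(1 / P + 1 / (P * h) + h ^ 4) / \<epsilon>\<^sup>2\<close> while \<open>h\<close> stays bounded,
  and all three terms tend to \<open>0\<close>.
\<close>

section \<open>Independent coordinates of a random vector with product density\<close>

text \<open>
  Both measures give a box the product of the masses of its sides, and boxes determine a measure
  on the product space.
\<close>
lemma density_PiM:
  fixes f :: "'i \<Rightarrow> 'b \<Rightarrow> ennreal"
  assumes I: "finite I"
    and N: "product_sigma_finite N" and D: "product_sigma_finite (\<lambda>i. density (N i) (f i))"
    and f[measurable]: "\<And>i. f i \<in> borel_measurable (N i)"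
  shows "density (PiM I N) (\<lambda>x. \<Prod>i\<in>I. f i (x i)) = PiM I (\<lambda>i. density (N i) (f i))"
proof (rule product_sigma_finite.PiM_eqI[OF D I])
  show "sets (density (PiM I N) (\<lambda>x. \<Prod>i\<in>I. f i (x i))) = sets (PiM I (\<lambda>i. density (N i) (f i)))"
    by (simp cong: sets_PiM_cong)
  fix A assume "\<And>i. i \<in> I \<Longrightarrow> A i \<in> sets (density (N i) (f i))"
  then have A[measurable]: "\<And>i. i \<in> I \<Longrightarrow> A i \<in> sets (N i)"
    by simp
  then have AI[measurable]: "Pi\<^sub>E I A \<in> sets (PiM I N)"
    using I by (intro sets_PiM_I_finite) auto
  have ind: "indicator (Pi\<^sub>E I A) x = (\<Prod>i\<in>I. indicator (A i) (x i) :: ennreal)"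
    if "x \<in> space (PiM I N)" for x
    using that I by (auto simp: indicator_def space_PiM PiE_iff prod_zero_iff)
  have "emeasure (density (PiM I N) (\<lambda>x. \<Prod>i\<in>I. f i (x i))) (Pi\<^sub>E I A)
      = (\<integral>\<^sup>+x. (\<Prod>i\<in>I. f i (x i)) * indicator (Pi\<^sub>E I A) x \<partial>PiM I N)"
    by (rule emeasure_density) measurable
  also have "\<dots> = (\<integral>\<^sup>+x. (\<Prod>i\<in>I. f i (x i) * indicator (A i) (x i)) \<partial>PiM I N)"
    by (intro nn_integral_cong) (simp add: ind prod.distrib)
  also have "\<dots> = (\<Prod>i\<in>I. \<integral>\<^sup>+x. f i x * indicator (A i) x \<partial>N i)"
    by (intro product_sigma_finite.product_nn_integral_prod[OF N I]) measurable
  also have "\<dots> = (\<Prod>i\<in>I. emeasure (density (N i) (f i)) (A i))"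
    by (intro prod.cong) (auto simp: emeasure_density)
  finally show "emeasure (density (PiM I N) (\<lambda>x. \<Prod>i\<in>I. f i (x i))) (Pi\<^sub>E I A)
      = (\<Prod>i\<in>I. emeasure (density (N i) (f i)) (A i))" .
qed

text \<open>
  The law of \<open>W\<close> is the product of the laws with densities \<open>f i\<close>, which is exactly what
  independence of the coordinates asserts.
\<close>
lemma (in prob_space) product_density_coordinates:
  fixes f :: "'i \<Rightarrow> 'b \<Rightarrow> ennreal"
  assumes I: "finite I" "I \<noteq> {}"
    and N: "product_sigma_finite N" and D: "\<And>i. prob_space (density (N i) (f i))"
    and f[measurable]: "\<And>i. f i \<in> borel_measurable (N i)"
    and W: "distributed M (PiM I N) W (\<lambda>w. \<Prod>i\<in>I. f i (w i))"
  shows product_density_imp_distributed: "i \<in> I \<Longrightarrow> distributed M (N i) (\<lambda>\<omega>. W \<omega> i) (f i)"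
    and product_density_imp_indep_vars: "indep_vars N (\<lambda>i \<omega>. W \<omega> i) I"
proof -
  interpret D: product_prob_space "\<lambda>i. density (N i) (f i)" I
    using D by (simp add: product_prob_space_def product_prob_space_axioms_def
        product_sigma_finite_def prob_space_imp_sigma_finite)
  have Wm[measurable]: "W \<in> measurable M (PiM I N)"
    using W by (rule distributed_measurable)
  have distr_W: "distr M (PiM I N) W = PiM I (\<lambda>i. density (N i) (f i))"
    using density_PiM[OF I(1) N _ f] D.product_sigma_finite_axioms
    by (simp add: distributed_distr_eq_density[OF W])
  have Wi[measurable]: "(\<lambda>\<omega>. W \<omega> i) \<in> measurable M (N i)" if "i \<in> I" for i
    using that by measurable
  have distr_Wi: "distr M (N i) (\<lambda>\<omega>. W \<omega> i) = density (N i) (f i)" if i: "i \<in> I" for i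
  proof -
    have "distr M (N i) (\<lambda>\<omega>. W \<omega> i) = distr (distr M (PiM I N) W) (N i) (\<lambda>w. w i)"
      using i by (subst distr_distr) (auto simp: comp_def)
    also have "\<dots> = distr (PiM I (\<lambda>i. density (N i) (f i))) (density (N i) (f i)) (\<lambda>w. w i)"
      unfolding distr_W by (intro distr_cong) auto
    also have "\<dots> = density (N i) (f i)"
      using i by (rule D.PiM_component)
    finally show ?thesis .
  qed
  then show "i \<in> I \<Longrightarrow> distributed M (N i) (\<lambda>\<omega>. W \<omega> i) (f i)"
    by (simp add: distributed_def)
  have "distr M (PiM I N) (\<lambda>\<omega>. \<lambda>i\<in>I. W \<omega> i) = distr M (PiM I N) W"
    using measurable_space[OF Wm]
    by (intro distr_cong) (auto simp: space_PiM intro!: PiE_restrict)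
  also have "\<dots> = PiM I (\<lambda>i. distr M (N i) (\<lambda>\<omega>. W \<omega> i))"
    unfolding distr_W by (intro PiM_cong) (auto simp: distr_Wi)
  finally show "indep_vars N (\<lambda>i \<omega>. W \<omega> i) I"
    using I Wi by (subst indep_vars_iff_distr_eq_PiM') auto
qed

section \<open>A weak law of large numbers with a bias term\<close>

text \<open>
  Expanding the square of the centred sum gives covariances, and those of distinct summands
  vanish.
\<close>
lemma (in prob_space) indep_vars_variance_sum:
  fixes X :: "'i \<Rightarrow> 'a \<Rightarrow> real"
  assumes I: "finite I" and indep: "indep_vars (\<lambda>_. borel) X I"
    and sq: "\<And>i. i \<in> I \<Longrightarrow> integrable M (\<lambda>\<omega>. (X i \<omega>)\<^sup>2)"
  shows "variance (\<lambda>\<omega>. \<Sum>i\<in>I. X i \<omega>) = (\<Sum>i\<in>I. variance (X i))"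
    and "integrable M (\<lambda>\<omega>. ((\<Sum>i\<in>I. X i \<omega>) - expectation (\<lambda>\<omega>. \<Sum>i\<in>I. X i \<omega>))\<^sup>2)"
proof -
  have Xm[measurable]: "X i \<in> borel_measurable M" if "i \<in> I" for i
    using indep that by (auto simp: indep_vars_def)
  have X: "integrable M (X i)" if "i \<in> I" for i
    using square_integrable_imp_integrable[OF Xm sq] that by auto
  define Y where "Y i \<omega> = X i \<omega> - expectation (X i)" for i \<omega>
  have Y: "integrable M (Y i)" if "i \<in> I" for i
    unfolding Y_def using X that by auto
  have EY: "expectation (Y i) = 0" if "i \<in> I" for i
    unfolding Y_def using X that by (simp add: prob_space)
  have Y2: "integrable M (\<lambda>\<omega>. Y i \<omega> * Y i \<omega>)" if "i \<in> I" for i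
  proof -
    have "(\<lambda>\<omega>. Y i \<omega> * Y i \<omega>) =
        (\<lambda>\<omega>. (X i \<omega>)\<^sup>2 - 2 * expectation (X i) * X i \<omega> + (expectation (X i))\<^sup>2)"
      by (auto simp: Y_def power2_eq_square algebra_simps)
    then show ?thesis using X sq that by simp
  qed
  have indY: "indep_vars (\<lambda>_. borel) Y I"
    unfolding Y_def by (rule indep_vars_compose2[OF indep]) measurable
  have pair: "integrable M (\<lambda>\<omega>. Y i \<omega> * Y j \<omega>) \<and> expectation (\<lambda>\<omega>. Y i \<omega> * Y j \<omega>) = 0"
    if ij: "i \<in> I" "j \<in> I" "i \<noteq> j" for i j
  proof -
    have "indep_vars (\<lambda>_. borel) Y {i, j}"
      using indep_vars_subset[OF indY] ij by auto
    then show ?thesis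
      using indep_vars_integrable[of "{i, j}" Y] indep_vars_lebesgue_integral[of "{i, j}" Y]
        ij Y EY by auto
  qed
  have int: "integrable M (\<lambda>\<omega>. Y i \<omega> * Y j \<omega>)" if "i \<in> I" "j \<in> I" for i j
    using pair[OF that] Y2 that by (cases "i = j") auto
  have "(\<Sum>i\<in>I. X i \<omega>) - expectation (\<lambda>\<omega>. \<Sum>i\<in>I. X i \<omega>) = (\<Sum>i\<in>I. Y i \<omega>)" for \<omega>
    using X by (simp add: Y_def sum_subtractf Bochner_Integration.integral_sum)
  then have *: "(\<lambda>\<omega>. ((\<Sum>i\<in>I. X i \<omega>) - expectation (\<lambda>\<omega>. \<Sum>i\<in>I. X i \<omega>))\<^sup>2)
      = (\<lambda>\<omega>. \<Sum>i\<in>I. \<Sum>j\<in>I. Y i \<omega> * Y j \<omega>)"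
    by (simp add: power2_eq_square sum_product)
  show "integrable M (\<lambda>\<omega>. ((\<Sum>i\<in>I. X i \<omega>) - expectation (\<lambda>\<omega>. \<Sum>i\<in>I. X i \<omega>))\<^sup>2)"
    unfolding * using int by auto
  have "variance (\<lambda>\<omega>. \<Sum>i\<in>I. X i \<omega>) = (\<Sum>i\<in>I. \<Sum>j\<in>I. expectation (\<lambda>\<omega>. Y i \<omega> * Y j \<omega>))"
    unfolding * using int by (simp add: Bochner_Integration.integral_sum)
  also have "\<dots> = (\<Sum>i\<in>I. \<Sum>j\<in>I. if j = i then expectation (\<lambda>\<omega>. Y i \<omega> * Y i \<omega>) else 0)"
    using pair by (intro sum.cong) auto
  also have "\<dots> = (\<Sum>i\<in>I. variance (X i))"
    using I by (simp add: Y_def power2_eq_square)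
  finally show "variance (\<lambda>\<omega>. \<Sum>i\<in>I. X i \<omega>) = (\<Sum>i\<in>I. variance (X i))" .
qed

text \<open>
  Chebyshev's inequality for a mean of independent summands whose expectations only approximate
  the targets \<open>r i\<close>: the second moment of the error splits into a variance, which averaging
  divides by the number of summands, and the squared bias, which averaging leaves in place.
\<close>
lemma (in prob_space) prob_indep_mean_deviation:
  fixes X :: "'i \<Rightarrow> 'a \<Rightarrow> real"
  assumes I: "finite I" "I \<noteq> {}" and indep: "indep_vars (\<lambda>_. borel) X I"
    and sq: "\<And>i. i \<in> I \<Longrightarrow> integrable M (\<lambda>\<omega>. (X i \<omega>)\<^sup>2)"
    and V: "\<And>i. i \<in> I \<Longrightarrow> expectation (\<lambda>\<omega>. (X i \<omega>)\<^sup>2) \<le> V"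
    and \<beta>: "\<And>i. i \<in> I \<Longrightarrow> \<bar>expectation (X i) - r i\<bar> \<le> \<beta>"
    and \<epsilon>: "\<epsilon> > 0"
  shows "prob {\<omega> \<in> space M. \<bar>((\<Sum>i\<in>I. X i \<omega>) - (\<Sum>i\<in>I. r i)) / card I\<bar> > \<epsilon>}
      \<le> (V / card I + \<beta>\<^sup>2) / \<epsilon>\<^sup>2"
proof -
  have Xm[measurable]: "X i \<in> borel_measurable M" if "i \<in> I" for i
    using indep that by (auto simp: indep_vars_def)
  have X: "integrable M (X i)" if "i \<in> I" for i
    using square_integrable_imp_integrable[OF Xm sq] that by auto
  define n where "n = real (card I)"
  have n: "n > 0" using I by (simp add: n_def card_gt_0_iff)
  define S where "S \<omega> = (\<Sum>i\<in>I. X i \<omega>)" for \<omega>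
  define \<mu> where "\<mu> = expectation S"
  define R where "R = (\<Sum>i\<in>I. r i)"
  have S: "integrable M S" unfolding S_def using X by auto
  have Sm[measurable]: "S \<in> borel_measurable M" using S by auto
  have intS: "integrable M (\<lambda>\<omega>. (S \<omega> - \<mu>)\<^sup>2)"
    unfolding S_def \<mu>_def by (rule indep_vars_variance_sum(2)[OF I(1) indep sq])
  have split: "((S \<omega> - R) / n)\<^sup>2 = ((S \<omega> - \<mu>)\<^sup>2 + 2 * (\<mu> - R) * (S \<omega> - \<mu>) + (\<mu> - R)\<^sup>2) / n\<^sup>2" for \<omega>
    by (simp add: power_divide) (simp add: power2_eq_square algebra_simps)
  have int: "integrable M (\<lambda>\<omega>. ((S \<omega> - R) / n)\<^sup>2)"
    unfolding split using intS S by auto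
  have "(\<Sum>i\<in>I. variance (X i)) \<le> (\<Sum>i\<in>I. V)"
  proof (rule sum_mono)
    fix i assume i: "i \<in> I"
    show "variance (X i) \<le> V"
      using V[OF i] variance_eq[OF X[OF i] sq[OF i]] by (smt (verit) zero_le_power2)
  qed
  then have var: "expectation (\<lambda>\<omega>. (S \<omega> - \<mu>)\<^sup>2) \<le> n * V"
    using indep_vars_variance_sum(1)[OF I(1) indep sq]
    by (simp add: S_def[symmetric] \<mu>_def n_def)
  have "\<bar>\<mu> - R\<bar> = \<bar>\<Sum>i\<in>I. expectation (X i) - r i\<bar>"
    using X by (simp add: \<mu>_def S_def[abs_def] R_def sum_subtractf Bochner_Integration.integral_sum)
  also have "\<dots> \<le> (\<Sum>i\<in>I. \<beta>)"
    by (rule order_trans[OF sum_abs]) (intro sum_mono \<beta>)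
  finally have "\<bar>\<mu> - R\<bar> \<le> n * \<beta>" by (simp add: n_def)
  then have bias: "(\<mu> - R)\<^sup>2 \<le> (n * \<beta>)\<^sup>2"
    by (metis abs_ge_zero power2_abs power_mono)
  have "expectation (\<lambda>\<omega>. ((S \<omega> - R) / n)\<^sup>2)
      = (expectation (\<lambda>\<omega>. (S \<omega> - \<mu>)\<^sup>2) + (\<mu> - R)\<^sup>2) / n\<^sup>2"
    unfolding split using intS S by (simp add: prob_space \<mu>_def)
  also have "\<dots> \<le> (n * V + (n * \<beta>)\<^sup>2) / n\<^sup>2"
    using var bias by (intro divide_right_mono) auto
  also have "\<dots> = V / n + \<beta>\<^sup>2"
    using n by (simp add: field_simps power2_eq_square)
  finally have E: "expectation (\<lambda>\<omega>. ((S \<omega> - R) / n)\<^sup>2) \<le> V / n + \<beta>\<^sup>2" .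
  have "prob {\<omega> \<in> space M. \<bar>(S \<omega> - R) / n\<bar> > \<epsilon>} \<le> prob {\<omega> \<in> space M. \<bar>(S \<omega> - R) / n\<bar> \<ge> \<epsilon>}"
    by (intro finite_measure_mono) auto
  also have "\<dots> \<le> expectation (\<lambda>\<omega>. ((S \<omega> - R) / n)\<^sup>2) / \<epsilon>\<^sup>2"
    by (intro second_moment_method int \<epsilon>) measurable
  also have "\<dots> \<le> (V / n + \<beta>\<^sup>2) / \<epsilon>\<^sup>2"
    using E by (intro divide_right_mono) auto
  finally show ?thesis by (simp add: S_def R_def n_def)
qed


section \<open>Gaussian smoothing\<close>

lemma scaled_normal_density_le_1:
  assumes "s > 0"
  shows "s * normal_density \<mu> s y \<le> 1"
proof -
  have "1 \<le> sqrt (2 * pi)"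
    using pi_gt3 by (intro real_le_rsqrt) auto
  moreover have "exp (- (y - \<mu>)\<^sup>2 / (2 * s\<^sup>2)) \<le> 1"
    by simp
  ultimately have "exp (- (y - \<mu>)\<^sup>2 / (2 * s\<^sup>2)) \<le> sqrt (2 * pi)"
    by linarith
  moreover have "s * normal_density \<mu> s y = exp (- (y - \<mu>)\<^sup>2 / (2 * s\<^sup>2)) / sqrt (2 * pi)"
    using assms by (simp add: normal_density_def real_sqrt_mult)
  ultimately show ?thesis
    using pi_gt_zero by (simp add: divide_le_eq)
qed

text \<open>
  By the symmetry of the kernel this is the convolution of \<open>N(0, \<sigma>\<^sup>2)\<close> with \<open>N(0, h\<^sup>2)\<close> at
  the point \<open>c - x\<close>.
\<close>
lemma normal_density_smoothing:
  assumes \<sigma>: "\<sigma> > 0" and h: "h > 0"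
  shows "has_bochner_integral lborel (\<lambda>w. normal_density 0 \<sigma> w * normal_density c h (x + w))
           (normal_density 0 (sqrt (\<sigma>\<^sup>2 + h\<^sup>2)) (c - x))"
proof (rule has_bochner_integral_nn_integral)
  have sym: "normal_density c h (x + w) = normal_density 0 h ((c - x) - w)" for w
    by (simp add: normal_density_def power2_eq_square algebra_simps)
  show "(\<integral>\<^sup>+w. ennreal (normal_density 0 \<sigma> w * normal_density c h (x + w)) \<partial>lborel)
      = ennreal (normal_density 0 (sqrt (\<sigma>\<^sup>2 + h\<^sup>2)) (c - x))"
    using fun_cong[OF conv_normal_density_zero_mean[OF h \<sigma>], of "c - x"]
    unfolding sym by (simp add: mult.commute add.commute)
qed auto

text \<open>
  Multiplying the density by its standard deviation \<open>s\<close> cancels the normalisation, so that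
  only the exponents \<open>a\<^sup>2 / (2 * s\<^sup>2)\<close> and \<open>a\<^sup>2 / (2 * \<sigma>\<^sup>2)\<close> are compared. Their difference is
  proportional to the first of them, and the decay of the exponential (\<open>v * exp (- v) \<le> 1\<close> for \<open>v \<ge> 0\<close>)
  absorbs that factor. This is what makes the estimate uniform in \<open>a\<close>.
\<close>
lemma scaled_normal_density_diff:
  assumes \<sigma>: "\<sigma> > 0" and s: "s \<ge> \<sigma>"
  shows "\<bar>s * normal_density 0 s a - \<sigma> * normal_density 0 \<sigma> a\<bar> \<le> (s\<^sup>2 - \<sigma>\<^sup>2) / \<sigma>\<^sup>2"
proof -
  have s0: "s > 0" using assms by simp
  have sq: "\<sigma>\<^sup>2 \<le> s\<^sup>2" using assms by (intro power_mono) auto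
  have pi1: "1 \<le> sqrt (2 * pi)"
    using pi_gt3 by (intro real_le_rsqrt) auto
  have scaled: "t * normal_density 0 t a = exp (- (a\<^sup>2 / (2 * t\<^sup>2))) / sqrt (2 * pi)" if "t > 0" for t
    using that by (simp add: normal_density_def real_sqrt_mult)
  define u v where "u = a\<^sup>2 / (2 * \<sigma>\<^sup>2)" and "v = a\<^sup>2 / (2 * s\<^sup>2)"
  have v0: "v \<ge> 0" by (simp add: v_def)
  have uv: "u - v = v * ((s\<^sup>2 - \<sigma>\<^sup>2) / \<sigma>\<^sup>2)"
    using \<sigma> s0 by (simp add: u_def v_def field_simps)
  have q0: "0 \<le> (s\<^sup>2 - \<sigma>\<^sup>2) / \<sigma>\<^sup>2"
    using sq by simp
  have vu: "v \<le> u"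
    using uv v0 q0 by (smt (verit) mult_nonneg_nonneg)
  have "v * exp (- v) \<le> 1"
  proof -
    have "v \<le> exp v" using exp_ge_add_one_self[of v] by linarith
    then show ?thesis by (simp add: exp_minus divide_simps)
  qed
  have "1 - exp (- (u - v)) \<le> u - v"
    using exp_ge_add_one_self[of "- (u - v)"] by linarith
  then have "exp (- v) * (1 - exp (- (u - v))) \<le> exp (- v) * (u - v)"
    by (intro mult_left_mono) auto
  also have "\<dots> = (v * exp (- v)) * ((s\<^sup>2 - \<sigma>\<^sup>2) / \<sigma>\<^sup>2)"
    by (simp add: uv)
  also have "\<dots> \<le> 1 * ((s\<^sup>2 - \<sigma>\<^sup>2) / \<sigma>\<^sup>2)"
    by (intro mult_right_mono q0) fact
  also have "exp (- v) * (1 - exp (- (u - v))) = exp (- v) - exp (- u)"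
    by (simp add: right_diff_distrib flip: exp_add)
  finally have le: "exp (- v) - exp (- u) \<le> (s\<^sup>2 - \<sigma>\<^sup>2) / \<sigma>\<^sup>2" by simp
  have ge: "0 \<le> exp (- v) - exp (- u)" using vu by simp
  have "\<bar>s * normal_density 0 s a - \<sigma> * normal_density 0 \<sigma> a\<bar> = (exp (- v) - exp (- u)) / sqrt (2 * pi)"
    using scaled[OF s0] scaled[OF \<sigma>] ge by (simp add: u_def v_def flip: diff_divide_distrib)
  also have "\<dots> \<le> exp (- v) - exp (- u)"
    using ge pi1 by (simp add: divide_le_eq mult_le_cancel_left1)
  finally show ?thesis using le by linarith
qed

section \<open>One coordinate of the score\<close>

definition threshold :: "real \<Rightarrow> real \<Rightarrow> real" where
  "threshold lam y = (if \<bar>y\<bar> < lam then 0 else y)"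

text \<open>
  Stein's unbiased risk estimate with the almost-everywhere derivative of the thresholding
  function in place of its weak derivative. The squares cancel above the threshold, so it is
  bounded although its first summand is not.
\<close>
definition bounded_score :: "real \<Rightarrow> real \<Rightarrow> real \<Rightarrow> real" where
  "bounded_score \<sigma> lam y = (y\<^sup>2 - \<sigma>\<^sup>2) + of_bool (\<bar>y\<bar> > lam) * (2 * \<sigma>\<^sup>2 - y\<^sup>2)"

text \<open>
  The contribution of the two jumps of the thresholding function, each of size \<open>lam\<close>. The
  point masses \<open>2 * \<sigma>\<^sup>2 * lam * \<delta>\<close> that Stein's formula asks for at \<open>\<plusminus> lam\<close> are replaced by
  normal densities of width \<open>h\<close>. The factor \<open>sqrt (\<sigma>\<^sup>2 + h\<^sup>2)\<close> in place of one \<open>\<sigma>\<close> cancels the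
  normalisation of the density that results from smoothing.
\<close>
definition jump_score :: "real \<Rightarrow> real \<Rightarrow> real \<Rightarrow> real \<Rightarrow> real" where
  "jump_score \<sigma> lam h y =
     2 * \<sigma> * lam * sqrt (\<sigma>\<^sup>2 + h\<^sup>2) * (normal_density (- lam) h y + normal_density lam h y)"

lemma measurable_threshold[measurable]: "threshold lam \<in> borel_measurable borel"
  unfolding threshold_def by measurable

lemma measurable_bounded_score[measurable]: "bounded_score \<sigma> lam \<in> borel_measurable borel"
  unfolding bounded_score_def of_bool_def by measurable

lemma measurable_jump_score[measurable]: "jump_score \<sigma> lam h \<in> borel_measurable borel"
  unfolding jump_score_def by measurable

lemma score_HT_eq_sum:
  assumes "h > 0"
  shows "score_HT P \<sigma> y lam h = (\<Sum>i<P. bounded_score \<sigma> lam (y i) + jump_score \<sigma> lam h (y i))"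
  unfolding score_HT_def bounded_score_def jump_score_def normal_density_def
  using assms by (intro sum.cong) (simp_all add: real_sqrt_mult algebra_simps)

lemma bounded_score_bound:
  assumes "lam > 0"
  shows "\<bar>bounded_score \<sigma> lam y\<bar> \<le> lam\<^sup>2 + \<sigma>\<^sup>2"
proof (cases "\<bar>y\<bar> > lam")
  case False
  then have "y\<^sup>2 \<le> lam\<^sup>2" using assms by (intro abs_le_square_iff[THEN iffD1]) auto
  then show ?thesis using False by (simp add: bounded_score_def abs_le_iff add_increasing)
qed (simp add: bounded_score_def)

lemma integrable_normal_density_mult_bounded:
  fixes g :: "real \<Rightarrow> real"
  assumes "\<sigma> > 0" and [measurable]: "g \<in> borel_measurable borel" and "\<And>w. \<bar>g w\<bar> \<le> B"
  shows "integrable lborel (\<lambda>w. normal_density 0 \<sigma> w * g w)"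
proof (rule Bochner_Integration.integrable_bound)
  show "integrable lborel (\<lambda>w. normal_density 0 \<sigma> w * B)"
    using assms by auto
  show "AE w in lborel. norm (normal_density 0 \<sigma> w * g w) \<le> norm (normal_density 0 \<sigma> w * B)"
    using assms by (auto simp: abs_mult intro!: mult_left_mono order_trans[OF assms(3)])
qed simp

text \<open>
  Stein's identity for hard thresholding. The difference of the loss and \<open>bounded_score\<close> is
  \<open>w\<^sup>2 - \<sigma>\<^sup>2\<close> plus \<open>2 * (\<sigma>\<^sup>2 - w * (x + w))\<close> on the region where the observation is set
  to zero. The first part has mean zero; against the Gaussian weight, the second is an exact
  derivative, whose boundary values are the jump contributions.
\<close>
lemma stein_hard_threshold:
  assumes \<sigma>: "\<sigma> > 0" and lam: "lam > 0"
  shows "has_bochner_integral lborel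
           (\<lambda>w. normal_density 0 \<sigma> w * ((threshold lam (x + w) - x)\<^sup>2 - bounded_score \<sigma> lam (x + w)))
           (2 * \<sigma>\<^sup>2 * lam * (normal_density 0 \<sigma> (- lam - x) + normal_density 0 \<sigma> (lam - x)))"
proof -
  let ?\<phi> = "normal_density 0 \<sigma>"
  let ?J = "{- lam - x .. lam - x}"
  let ?g = "\<lambda>w. ?\<phi> w * (\<sigma>\<^sup>2 - w * (x + w))"
  define G where "G w = \<sigma>\<^sup>2 * ((x + w) * ?\<phi> w)" for w
  have d\<phi>: "DERIV ?\<phi> w :> - (w / \<sigma>\<^sup>2) * ?\<phi> w" for w
    unfolding normal_density_def using \<sigma>
    by (auto intro!: derivative_eq_intros simp: field_simps power2_eq_square)
  have G': "DERIV G w :> ?g w" for w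
    unfolding G_def using \<sigma>
    by (auto intro!: derivative_eq_intros d\<phi> simp: field_simps)
  have J: "has_bochner_integral lborel (\<lambda>w. ?g w * indicator ?J w) (G (lam - x) - G (- lam - x))"
  proof (rule has_bochner_integral_FTC_Icc_real)
    show "isCont ?g w" for w
      using \<sigma> DERIV_isCont[OF d\<phi>] by (auto intro!: continuous_intros)
  qed (use lam G' in auto)
  have V: "has_bochner_integral lborel (\<lambda>w. ?\<phi> w * w\<^sup>2 - ?\<phi> w * \<sigma>\<^sup>2) 0"
  proof -
    have "has_bochner_integral lborel (\<lambda>w. ?\<phi> w * w\<^sup>2) (\<sigma>\<^sup>2)"
      using normal_moment_even[OF \<sigma>, of 0 1] \<sigma> by (simp add: fact_numeral)
    moreover have "has_bochner_integral lborel (\<lambda>w. ?\<phi> w * \<sigma>\<^sup>2) (1 * \<sigma>\<^sup>2)"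
      using \<sigma> by (intro has_bochner_integral_mult_left) (auto simp: has_bochner_integral_iff)
    ultimately show ?thesis
      using has_bochner_integral_diff by fastforce
  qed
  have "has_bochner_integral lborel
      (\<lambda>w. (?\<phi> w * w\<^sup>2 - ?\<phi> w * \<sigma>\<^sup>2) + 2 * (?g w * indicator ?J w))
      (0 + 2 * (G (lam - x) - G (- lam - x)))"
    by (intro has_bochner_integral_add V has_bochner_integral_mult_right J)
  also have "0 + 2 * (G (lam - x) - G (- lam - x))
      = 2 * \<sigma>\<^sup>2 * lam * (?\<phi> (- lam - x) + ?\<phi> (lam - x))"
    by (simp add: G_def algebra_simps)
  also have "has_bochner_integral lborel
        (\<lambda>w. (?\<phi> w * w\<^sup>2 - ?\<phi> w * \<sigma>\<^sup>2) + 2 * (?g w * indicator ?J w)) = has_bochner_integral lborel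
        (\<lambda>w. ?\<phi> w * ((threshold lam (x + w) - x)\<^sup>2 - bounded_score \<sigma> lam (x + w)))"
  proof (intro ext has_bochner_integral_cong_AE)
    (* At the thresholds themselves the estimator keeps the observation, while bounded_score takes
       the value that belongs to a discarded one. *)
    have "AE w in lborel. w \<noteq> lam - x \<and> w \<noteq> - lam - x"
      using AE_lborel_singleton by auto
    then show "AE w in lborel. (?\<phi> w * w\<^sup>2 - ?\<phi> w * \<sigma>\<^sup>2) + 2 * (?g w * indicator ?J w)
        = ?\<phi> w * ((threshold lam (x + w) - x)\<^sup>2 - bounded_score \<sigma> lam (x + w))"
    proof (rule AE_mp, intro AE_I2 impI)
      fix w assume w: "w \<noteq> lam - x \<and> w \<noteq> - lam - x"
      consider "\<bar>x + w\<bar> < lam" | "\<bar>x + w\<bar> > lam"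
        using w by linarith
      then show "(?\<phi> w * w\<^sup>2 - ?\<phi> w * \<sigma>\<^sup>2) + 2 * (?g w * indicator ?J w)
        = ?\<phi> w * ((threshold lam (x + w) - x)\<^sup>2 - bounded_score \<sigma> lam (x + w))"
      proof cases
        case 1
        then have "w \<in> ?J" by auto
        then show ?thesis using 1
          by (simp add: threshold_def bounded_score_def power2_eq_square algebra_simps)
      next
        case 2
        then have "w \<notin> ?J" by auto
        then show ?thesis using 2
          by (simp add: threshold_def bounded_score_def power2_eq_square algebra_simps)
      qed
    qed
  qed measurable
  finally show ?thesis .
qed

lemma integrable_bounded_score:
  assumes "\<sigma> > 0" "lam > 0"
  shows "integrable lborel (\<lambda>w. normal_density 0 \<sigma> w * bounded_score \<sigma> lam (x + w))"
  using assms bounded_score_bound by (intro integrable_normal_density_mult_bounded) auto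

text \<open>
  The loss is the sum of \<open>bounded_score\<close> and the integrand of \<open>stein_hard_threshold\<close>.
\<close>
lemma integrable_threshold_loss:
  assumes "\<sigma> > 0" "lam > 0"
  shows "integrable lborel (\<lambda>w. normal_density 0 \<sigma> w * (threshold lam (x + w) - x)\<^sup>2)"
  using Bochner_Integration.integrable_add[OF
      integrable_bounded_score[OF assms, of x] integrable.intros[OF stein_hard_threshold[OF assms, of x]]]
  by (simp add: algebra_simps)

lemma jump_score_expectation:
  assumes "\<sigma> > 0" "h > 0"
  shows "has_bochner_integral lborel (\<lambda>w. normal_density 0 \<sigma> w * jump_score \<sigma> lam h (x + w))
    (2 * \<sigma> * lam * sqrt (\<sigma>\<^sup>2 + h\<^sup>2) * (normal_density 0 (sqrt (\<sigma>\<^sup>2 + h\<^sup>2)) (- lam - x)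
       + normal_density 0 (sqrt (\<sigma>\<^sup>2 + h\<^sup>2)) (lam - x)))"
  using has_bochner_integral_mult_right[OF has_bochner_integral_add[OF
      normal_density_smoothing[OF assms, of "- lam" x] normal_density_smoothing[OF assms, of lam x]],
      of "2 * \<sigma> * lam * sqrt (\<sigma>\<^sup>2 + h\<^sup>2)"]
  by (simp add: jump_score_def algebra_simps)

text \<open>
  The mean of \<open>bounded_score\<close> falls short of the risk by the jump contributions of
  \<open>stein_hard_threshold\<close>, in which the normal density has standard deviation \<open>\<sigma>\<close>. The mean of
  \<open>jump_score\<close> has the same form with \<open>sqrt (\<sigma>\<^sup>2 + h\<^sup>2)\<close>, and \<open>scaled_normal_density_diff\<close>
  compares the two without reference to the signal \<open>x\<close>.
\<close>
lemma score_bias: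
  assumes \<sigma>: "\<sigma> > 0" and lam: "lam > 0" and h: "h > 0"
  shows "\<bar>(\<integral>w. normal_density 0 \<sigma> w * (bounded_score \<sigma> lam (x + w) + jump_score \<sigma> lam h (x + w)) \<partial>lborel)
      - (\<integral>w. normal_density 0 \<sigma> w * (threshold lam (x + w) - x)\<^sup>2 \<partial>lborel)\<bar> \<le> 4 * lam * h\<^sup>2 / \<sigma>"
proof -
  let ?\<phi> = "normal_density 0 \<sigma>"
  let ?s = "sqrt (\<sigma>\<^sup>2 + h\<^sup>2)"
  let ?\<Delta> = "\<lambda>a. ?s * normal_density 0 ?s a - \<sigma> * ?\<phi> a"
  note int[simp] = integrable_bounded_score[OF \<sigma> lam, of x] integrable_threshold_loss[OF \<sigma> lam, of x]
    integrable.intros[OF jump_score_expectation[OF \<sigma> h, of lam x]]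
  have s: "\<sigma> \<le> ?s" using \<sigma> by (intro real_le_rsqrt) auto
  have \<Delta>: "\<bar>?\<Delta> a\<bar> \<le> h\<^sup>2 / \<sigma>\<^sup>2" for a
    using scaled_normal_density_diff[OF \<sigma> s, of a] by simp
  have "(\<integral>w. ?\<phi> w * (bounded_score \<sigma> lam (x + w) + jump_score \<sigma> lam h (x + w)) \<partial>lborel)
      - (\<integral>w. ?\<phi> w * (threshold lam (x + w) - x)\<^sup>2 \<partial>lborel)
     = (\<integral>w. ?\<phi> w * jump_score \<sigma> lam h (x + w) \<partial>lborel)
      - (\<integral>w. ?\<phi> w * ((threshold lam (x + w) - x)\<^sup>2 - bounded_score \<sigma> lam (x + w)) \<partial>lborel)"
    by (simp add: distrib_left right_diff_distrib)
  also have "\<dots> = 2 * \<sigma> * lam * (?\<Delta> (- lam - x) + ?\<Delta> (lam - x))"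
    unfolding has_bochner_integral_integral_eq[OF jump_score_expectation[OF \<sigma> h]]
      has_bochner_integral_integral_eq[OF stein_hard_threshold[OF \<sigma> lam]]
    by (simp add: power2_eq_square algebra_simps)
  also have "\<bar>\<dots>\<bar> \<le> 2 * \<sigma> * lam * (h\<^sup>2 / \<sigma>\<^sup>2 + h\<^sup>2 / \<sigma>\<^sup>2)"
    unfolding abs_mult using \<sigma> lam
    by (intro mult_mono order_trans[OF abs_triangle_ineq] add_mono \<Delta>) auto
  also have "\<dots> = 4 * lam * h\<^sup>2 / \<sigma>"
    using \<sigma> by (simp add: field_simps power2_eq_square)
  finally show ?thesis .
qed

text \<open>
  A kernel of width \<open>h\<close> is at most \<open>1 / h\<close>, so its square is at most the kernel itself divided
  by \<open>h\<close>. The kernel has a bounded mean, which leaves a single factor \<open>1 / h\<close>. Averaging over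
  \<open>P\<close> coordinates turns it into \<open>1 / (P * h)\<close>, the quantity that has to vanish in the limit.
\<close>
lemma score_second_moment:
  fixes x :: real
  assumes \<sigma>: "\<sigma> > 0" and lam: "lam > 0" and h: "h > 0"
  defines "f \<equiv> \<lambda>w. normal_density 0 \<sigma> w * (bounded_score \<sigma> lam (x + w) + jump_score \<sigma> lam h (x + w))\<^sup>2"
  shows "integrable lborel f"
    and "integral\<^sup>L lborel f \<le> 2 * (lam\<^sup>2 + \<sigma>\<^sup>2)\<^sup>2 + 32 * \<sigma> * lam\<^sup>2 * (\<sigma>\<^sup>2 + h\<^sup>2) / h"
proof -
  let ?\<phi> = "normal_density 0 \<sigma>"
  let ?s = "sqrt (\<sigma>\<^sup>2 + h\<^sup>2)"
  define B where "B = (lam\<^sup>2 + \<sigma>\<^sup>2)\<^sup>2"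
  define K where "K = 2 * \<sigma> * lam * ?s"
  let ?n = "\<lambda>c w. normal_density c h (x + w)"
  let ?g = "\<lambda>w. 2 * B * ?\<phi> w + 4 * K\<^sup>2 / h * (?\<phi> w * ?n (- lam) w + ?\<phi> w * ?n lam w)"
  have I: "has_bochner_integral lborel ?g (2 * B * 1 + 4 * K\<^sup>2 / h *
      (normal_density 0 ?s (- lam - x) + normal_density 0 ?s (lam - x)))"
    using \<sigma> h by (intro has_bochner_integral_add has_bochner_integral_mult_right normal_density_smoothing)
      (auto simp: has_bochner_integral_iff)
  have n2: "(?n c w)\<^sup>2 \<le> ?n c w / h" for c w
  proof -
    have "?n c w \<le> 1 / h"
      using scaled_normal_density_le_1[OF h, of c "x + w"] h by (simp add: field_simps)
    then have "?n c w * ?n c w \<le> ?n c w * (1 / h)"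
      by (intro mult_left_mono) auto
    then show ?thesis by (simp add: power2_eq_square)
  qed
  have two: "(a + b)\<^sup>2 \<le> 2 * a\<^sup>2 + 2 * b\<^sup>2" for a b :: real
    using zero_le_power2[of "a - b"] unfolding power2_sum power2_diff by linarith
  have f: "0 \<le> f w \<and> f w \<le> ?g w" for w
  proof -
    have "(jump_score \<sigma> lam h (x + w))\<^sup>2 = K\<^sup>2 * (?n (- lam) w + ?n lam w)\<^sup>2"
      by (simp add: jump_score_def K_def power_mult_distrib)
    also have "\<dots> \<le> K\<^sup>2 * (2 * (?n (- lam) w / h) + 2 * (?n lam w / h))"
      using two[of "?n (- lam) w" "?n lam w"] n2[of "- lam" w] n2[of lam w]
      by (intro mult_left_mono) auto
    finally have j: "(jump_score \<sigma> lam h (x + w))\<^sup>2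
        \<le> 2 * K\<^sup>2 / h * (?n (- lam) w + ?n lam w)"
      by (simp add: algebra_simps add_divide_distrib)
    have "(bounded_score \<sigma> lam (x + w))\<^sup>2 \<le> B"
      unfolding B_def using bounded_score_bound[OF lam, of \<sigma> "x + w"]
      by (metis abs_ge_zero power2_abs power_mono)
    then have "(bounded_score \<sigma> lam (x + w) + jump_score \<sigma> lam h (x + w))\<^sup>2
        \<le> 2 * B + 2 * (2 * K\<^sup>2 / h * (?n (- lam) w + ?n lam w))"
      using j two[of "bounded_score \<sigma> lam (x + w)" "jump_score \<sigma> lam h (x + w)"] by linarith
    then have "f w \<le> ?\<phi> w * (2 * B + 2 * (2 * K\<^sup>2 / h * (?n (- lam) w + ?n lam w)))"
      unfolding f_def by (intro mult_left_mono) auto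
    then show ?thesis
      by (simp add: f_def algebra_simps)
  qed
  show int: "integrable lborel f"
  proof (rule Bochner_Integration.integrable_bound)
    show "integrable lborel ?g" using I by (rule integrable.intros)
    show "AE w in lborel. norm (f w) \<le> norm (?g w)"
      using f by (intro AE_I2) (smt (verit) real_norm_def)
    show "f \<in> borel_measurable lborel" unfolding f_def by measurable
  qed
  have "integral\<^sup>L lborel f \<le> integral\<^sup>L lborel ?g"
    using f int integrable.intros[OF I] by (intro integral_mono) auto
  also have "\<dots> = 2 * B + 4 * K\<^sup>2 / h *
      (normal_density 0 ?s (- lam - x) + normal_density 0 ?s (lam - x))"
    using has_bochner_integral_integral_eq[OF I] by simp
  also have "\<dots> \<le> 2 * B + 4 * K\<^sup>2 / h * (1 / \<sigma> + 1 / \<sigma>)"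
  proof -
    have "normal_density 0 ?s a \<le> 1 / \<sigma>" for a
    proof -
      have s: "\<sigma> \<le> ?s" using \<sigma> by (intro real_le_rsqrt) auto
      then have "\<sigma> * normal_density 0 ?s a \<le> ?s * normal_density 0 ?s a"
        by (intro mult_right_mono) auto
      also have "\<dots> \<le> 1"
        using less_le_trans[OF \<sigma> s] by (rule scaled_normal_density_le_1)
      finally show ?thesis using \<sigma> by (simp add: field_simps)
    qed
    then show ?thesis using h by (intro add_left_mono mult_left_mono add_mono) auto
  qed
  also have "\<dots> = 2 * B + 32 * \<sigma> * lam\<^sup>2 * (\<sigma>\<^sup>2 + h\<^sup>2) / h"
    using \<sigma> h by (simp add: K_def power_mult_distrib field_simps) (simp add: power2_eq_square power4_eq_xxxx)
  finally show "integral\<^sup>L lborel f \<le> 2 * (lam\<^sup>2 + \<sigma>\<^sup>2)\<^sup>2 + 32 * \<sigma> * lam\<^sup>2 * (\<sigma>\<^sup>2 + h\<^sup>2) / h"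
    by (simp add: B_def)
qed

section \<open>Concentration of the score around the risk\<close>

lemma (in prob_space) isotropic_normal_coordinates:
  assumes \<sigma>: "\<sigma> > 0" and P: "P \<ge> 1"
    and W: "distributed M (\<Pi>\<^sub>M i\<in>{..<P}. lborel) W (\<lambda>w. ennreal (iso_normal_density P \<sigma> w))"
  shows "i < P \<Longrightarrow> distributed M lborel (\<lambda>\<omega>. W \<omega> i) (\<lambda>w. ennreal (normal_density 0 \<sigma> w))"
    and "indep_vars (\<lambda>_. lborel) (\<lambda>i \<omega>. W \<omega> i) {..<P}"
proof -
  have N: "product_sigma_finite (\<lambda>i::nat. lborel :: real measure)"
    by (simp add: product_sigma_finite_def lborel.sigma_finite_measure_axioms)
  have W': "distributed M (\<Pi>\<^sub>M i\<in>{..<P}. lborel) W (\<lambda>w. \<Prod>i<P. ennreal (normal_density 0 \<sigma> (w i)))"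
    using W by (simp add: iso_normal_density_eq_prod prod_ennreal)
  have I: "finite {..<P}" "{..<P} \<noteq> {}" using P by (auto simp: lessThan_empty_iff)
  show "i < P \<Longrightarrow> distributed M lborel (\<lambda>\<omega>. W \<omega> i) (\<lambda>w. ennreal (normal_density 0 \<sigma> w))"
    using product_density_imp_distributed[OF I N _ _ W'] prob_space_normal_density[OF \<sigma>] by auto
  show "indep_vars (\<lambda>_. lborel) (\<lambda>i \<omega>. W \<omega> i) {..<P}"
    using product_density_imp_indep_vars[OF I N _ _ W'] prob_space_normal_density[OF \<sigma>] by auto
qed

text \<open>
  A bound at fixed \<open>P\<close> that is the same for every signal \<open>x\<close>: one term comes from the
  variance of the averaged score and the other from its bias.
\<close>
lemma (in prob_space) score_risk_deviation:
  assumes \<sigma>: "\<sigma> > 0" and lam: "lam > 0" and h: "h > 0" and P: "P \<ge> 1"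
    and W: "distributed M (\<Pi>\<^sub>M i\<in>{..<P}. lborel) W (\<lambda>w. ennreal (iso_normal_density P \<sigma> w))"
    and Y: "\<And>\<omega> i. \<omega> \<in> space M \<Longrightarrow> i < P \<Longrightarrow> Y \<omega> i = x i + W \<omega> i"
    and \<epsilon>: "\<epsilon> > 0"
  shows "prob {\<omega> \<in> space M. \<bar>(score_HT P \<sigma> (Y \<omega>) lam h
           - expectation (\<lambda>\<omega>'. (L2_set (\<lambda>i. hard_threshold (Y \<omega>') lam i - x i) {..<P})\<^sup>2)) / P\<bar> > \<epsilon>}
      \<le> ((2 * (lam\<^sup>2 + \<sigma>\<^sup>2)\<^sup>2 + 32 * \<sigma> * lam\<^sup>2 * (\<sigma>\<^sup>2 + h\<^sup>2) / h) / P + (4 * lam * h\<^sup>2 / \<sigma>)\<^sup>2) / \<epsilon>\<^sup>2"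
proof -
  define S where "S y = bounded_score \<sigma> lam y + jump_score \<sigma> lam h y" for y
  define X where "X i \<omega> = S (x i + W \<omega> i)" for i \<omega>
  define r where "r i = expectation (\<lambda>\<omega>. (threshold lam (x i + W \<omega> i) - x i)\<^sup>2)" for i
  have Sm[measurable]: "S \<in> borel_measurable borel" unfolding S_def by measurable
  note Wi = isotropic_normal_coordinates(1)[OF \<sigma> P W]
  have E: "expectation (\<lambda>\<omega>. g (W \<omega> i)) = (\<integral>w. normal_density 0 \<sigma> w * g w \<partial>lborel)"
    and I: "integrable M (\<lambda>\<omega>. g (W \<omega> i)) \<longleftrightarrow> integrable lborel (\<lambda>w. normal_density 0 \<sigma> w * g w)"
    if "i < P" and "g \<in> borel_measurable borel" for i and g :: "real \<Rightarrow> real"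
    using distributed_integral[OF Wi[OF that(1)], of g] distributed_integrable[OF Wi[OF that(1)], of g]
      that(2) by auto
  have indep: "indep_vars (\<lambda>_. borel) X {..<P}"
    unfolding X_def
    by (rule indep_vars_compose2[OF isotropic_normal_coordinates(2)[OF \<sigma> P W]]) measurable
  have dev: "prob {\<omega> \<in> space M. \<bar>((\<Sum>i<P. X i \<omega>) - (\<Sum>i<P. r i)) / card {..<P}\<bar> > \<epsilon>}
      \<le> ((2 * (lam\<^sup>2 + \<sigma>\<^sup>2)\<^sup>2 + 32 * \<sigma> * lam\<^sup>2 * (\<sigma>\<^sup>2 + h\<^sup>2) / h) / card {..<P} + (4 * lam * h\<^sup>2 / \<sigma>)\<^sup>2) / \<epsilon>\<^sup>2"
  proof (rule prob_indep_mean_deviation[OF _ _ indep _ _ _ \<epsilon>])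
    fix i assume "i \<in> {..<P}"
    then have i: "i < P" by simp
    show "integrable M (\<lambda>\<omega>. (X i \<omega>)\<^sup>2)"
      unfolding X_def using score_second_moment(1)[OF \<sigma> lam h, of "x i"]
      by (subst I[OF i, of "\<lambda>w. (S (x i + w))\<^sup>2"]) (auto simp: S_def)
    show "expectation (\<lambda>\<omega>. (X i \<omega>)\<^sup>2)
        \<le> 2 * (lam\<^sup>2 + \<sigma>\<^sup>2)\<^sup>2 + 32 * \<sigma> * lam\<^sup>2 * (\<sigma>\<^sup>2 + h\<^sup>2) / h"
      unfolding X_def using score_second_moment(2)[OF \<sigma> lam h, of "x i"]
      by (subst E[OF i, of "\<lambda>w. (S (x i + w))\<^sup>2"]) (auto simp: S_def)
    show "\<bar>expectation (X i) - r i\<bar> \<le> 4 * lam * h\<^sup>2 / \<sigma>"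
      unfolding X_def r_def using score_bias[OF \<sigma> lam h, of "x i"]
      by (subst E[OF i, of "\<lambda>w. S (x i + w)"], simp,
          subst E[OF i, of "\<lambda>w. (threshold lam (x i + w) - x i)\<^sup>2"]) (auto simp: S_def)
  qed (use P in \<open>auto simp: lessThan_empty_iff\<close>)
  have risk: "expectation (\<lambda>\<omega>. (L2_set (\<lambda>i. hard_threshold (Y \<omega>) lam i - x i) {..<P})\<^sup>2) = (\<Sum>i<P. r i)"
  proof -
    have "expectation (\<lambda>\<omega>. (L2_set (\<lambda>i. hard_threshold (Y \<omega>) lam i - x i) {..<P})\<^sup>2)
        = expectation (\<lambda>\<omega>. \<Sum>i<P. (threshold lam (x i + W \<omega> i) - x i)\<^sup>2)"
      by (intro Bochner_Integration.integral_cong refl)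
        (auto simp: L2_set_def sum_nonneg hard_threshold_def threshold_def Y intro!: sum.cong)
    also have "\<dots> = (\<Sum>i<P. r i)"
      unfolding r_def
    proof (rule Bochner_Integration.integral_sum)
      fix i assume "i \<in> {..<P}"
      then show "integrable M (\<lambda>\<omega>. (threshold lam (x i + W \<omega> i) - x i)\<^sup>2)"
        using integrable_threshold_loss[OF \<sigma> lam, of "x i"]
        by (subst I[of _ "\<lambda>w. (threshold lam (x i + w) - x i)\<^sup>2"]) auto
    qed
    finally show ?thesis .
  qed
  have score: "score_HT P \<sigma> (Y \<omega>) lam h = (\<Sum>i<P. X i \<omega>)" if "\<omega> \<in> space M" for \<omega>
    using that by (simp add: score_HT_eq_sum[OF h] X_def S_def Y)
  show ?thesis
    using dev unfolding risk by (simp add: score cong: conj_cong)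
qed

theorem corollary1:
  fixes \<sigma> lam :: real
    and x0 :: "nat \<Rightarrow> nat \<Rightarrow> real"
    and h :: "nat \<Rightarrow> real"
    and M :: "nat \<Rightarrow> 'a measure"
    and W Y :: "nat \<Rightarrow> 'a \<Rightarrow> nat \<Rightarrow> real"
  assumes "\<sigma> > 0" and "lam > 0"
    and "\<And>P. P \<ge> 1 \<Longrightarrow> prob_space (M P)"
    and "\<And>P. P \<ge> 1 \<Longrightarrow>
           distributed (M P) (\<Pi>\<^sub>M i\<in>{..<P}. lborel) (W P) (\<lambda>w. ennreal (iso_normal_density P \<sigma> w))"
    and "\<And>P \<omega> i. P \<ge> 1 \<Longrightarrow> \<omega> \<in> space (M P) \<Longrightarrow> i < P \<Longrightarrow> Y P \<omega> i = x0 P i + W P \<omega> i"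
    and "(\<lambda>P. l4_norm P (x0 P)) \<in> o(\<lambda>P. real P powr (1 / 2))"
    and "\<And>P. P \<ge> 1 \<Longrightarrow> h P > 0"
    and "h \<longlonglongrightarrow> 0"
    and "(\<lambda>P. inverse (real P) * inverse (h P)) \<longlonglongrightarrow> 0"
  shows "plim_to M
           (\<lambda>P \<omega>. 1 / real P *
              (score_HT P \<sigma> (Y P \<omega>) lam (h P)
               - prob_space.expectation (M P)
                   (\<lambda>\<omega>'. (L2_set (\<lambda>i. hard_threshold (Y P \<omega>') lam i - x0 P i) {..<P})\<^sup>2)))
           0"
  unfolding plim_to_def
proof (intro allI impI)
  fix \<epsilon> :: real assume \<epsilon>: "\<epsilon> > 0"
  let ?p = "\<lambda>P. measure (M P) {\<omega> \<in> space (M P). \<bar>1 / real P *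
      (score_HT P \<sigma> (Y P \<omega>) lam (h P) - prob_space.expectation (M P)
        (\<lambda>\<omega>'. (L2_set (\<lambda>i. hard_threshold (Y P \<omega>') lam i - x0 P i) {..<P})\<^sup>2)) - 0\<bar> > \<epsilon>}"
  let ?b = "\<lambda>P. (2 * (lam\<^sup>2 + \<sigma>\<^sup>2)\<^sup>2 * inverse (real P)
      + 32 * \<sigma> * lam\<^sup>2 * (\<sigma>\<^sup>2 + (h P)\<^sup>2) * (inverse (real P) * inverse (h P))
      + (4 * lam * (h P)\<^sup>2 / \<sigma>)\<^sup>2) / \<epsilon>\<^sup>2"
  have "?b \<longlonglongrightarrow> (2 * (lam\<^sup>2 + \<sigma>\<^sup>2)\<^sup>2 * 0 + 32 * \<sigma> * lam\<^sup>2 * (\<sigma>\<^sup>2 + 0\<^sup>2) * 0 + (4 * lam * 0\<^sup>2 / \<sigma>)\<^sup>2) / \<epsilon>\<^sup>2"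
    using assms(1) \<epsilon> by (intro tendsto_intros assms lim_inverse_n) auto
  then have lim: "?b \<longlonglongrightarrow> 0" by simp
  have bound: "?p P \<le> ?b P" if P: "P \<ge> 1" for P
  proof -
    interpret prob_space "M P" using assms(3)[OF P] .
    have b: "?b P = ((2 * (lam\<^sup>2 + \<sigma>\<^sup>2)\<^sup>2 + 32 * \<sigma> * lam\<^sup>2 * (\<sigma>\<^sup>2 + (h P)\<^sup>2) / h P) / P
        + (4 * lam * (h P)\<^sup>2 / \<sigma>)\<^sup>2) / \<epsilon>\<^sup>2"
      by (simp add: divide_inverse distrib_left distrib_right mult_ac)
    show ?thesis
      unfolding b using score_risk_deviation[OF assms(1) assms(2) assms(7)[OF P] P assms(4)[OF P] assms(5)[OF P] \<epsilon>]
      by simp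
  qed
  show "?p \<longlonglongrightarrow> 0"
  proof (rule tendsto_sandwich[OF _ _ tendsto_const lim])
    show "eventually (\<lambda>P. ?p P \<le> ?b P) sequentially"
      using bound by (auto simp: eventually_sequentially)
  qed simp
qed

end
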